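(* Let $a,b,r,\sigma,\rho$ be the parameters of the normal stochastic volatility model described in the context, and let $\omega$ be the (real) argument of the characteristic function. Consider the system of differential equations for $C$ and $D$, which are functions of $\tau=T-t$ (and of $\omega$): $$-\tfrac12\omega^2+\rho\sigma\omega i\,D+\tfrac12\sigma^2D^2-bD-\frac{\partial D}{\partial t}=0,$$ $$r\omega i+aD-\frac{\partial C}{\partial t}=0,$$ with $C(0;\omega)=0$ and $D(0;\omega)=0$. The solution to this system is given by $$C(\tau;\omega)=-ri\omega\tau+\frac{a}{\sigma^2}\left[(b-\rho\sigma i\omega-d)\tau-2\ln\left(\frac{1-ge^{-d\tau}}{1-g}\right)\right],$$ $$D(\tau;\omega)=\frac{b-\rho\sigma i\omega-d}{\sigma^2}\left(\frac{1-e^{-d\tau}}{1-ge^{-d\tau}}\right),$$ where $$g=\frac{b-\rho\sigma i\omega-d}{b-\rho\sigma i\omega+d},\qquad d=\sqrt{(b-\rho\sigma i\omega)^2+\sigma^2\omega^2}.$$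
   Context: Here $i$ is the imaginary unit, $t$ is the current time, $T$ is a later date, and $\tau=T-t$. The normal stochastic volatility model is $dx(t)=r\,dt+\sqrt{v(t)}\,dz_1(t)$, $dv(t)=(a-bv(t))\,dt+\sigma\sqrt{v(t)}\,dz_2(t)$, where $x(t)$ is the spot price of an asset, $z_1,z_2$ are Brownian motions with correlation $\rho$, $b$ is the mean reversion rate and $a/b$ is the long variance. The system arises when the conditional characteristic function of $x(T)$ given $x(t)=x$, $v(t)=v$ is sought in the form $f(x,v,t)=\exp[C(T-t)+D(T-t)v+i\omega x]$.
   Formalization: The drift term of C is taken as +riωτ, since −riωτ contradicts C'(0)=riω unless rω=0; the derivatives in the system are read as derivatives in τ; the mean reversion rate b is taken positive, σ nonzero, and ρ in [−1,1]. *)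

theory Defs
  imports "HOL-Analysis.Analysis"
begin

text \<open>
  The unknowns are functions of the time to maturity \<open>\<tau> = T - t\<close>, for a fixed argument \<open>\<omega>\<close> of the
  characteristic function; as \<open>t\<close> runs through \<open>[0, T]\<close>, so does \<open>\<tau>\<close>.  The derivatives written
  \<open>\<partial>C/\<partial>t\<close> and \<open>\<partial>D/\<partial>t\<close> in the system are derivatives with respect to the argument \<open>\<tau>\<close> of \<open>C\<close>
  and \<open>D\<close>: this is the system obtained by inserting \<open>f = exp (C (T - t) + D (T - t) v + \<i> \<omega> x)\<close>
  into the backward equation of the model.  At the end points they are one-sided.
\<close>

definition nsv_system ::
  "real \<Rightarrow> real \<Rightarrow> real \<Rightarrow> real \<Rightarrow> real \<Rightarrow> real \<Rightarrow> real \<Rightarrow> (real \<Rightarrow> complex) \<Rightarrow> (real \<Rightarrow> complex) \<Rightarrow> bool"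
  where
  "nsv_system a b r \<sigma> \<rho> \<omega> T C D \<longleftrightarrow>
     C 0 = 0 \<and> D 0 = 0 \<and>
     (\<forall>\<tau>\<in>{0..T}. \<exists>C' D'.
        (C has_vector_derivative C') (at \<tau> within {0..T}) \<and>
        (D has_vector_derivative D') (at \<tau> within {0..T}) \<and>
        - (1/2) * of_real \<omega> ^ 2 + of_real \<rho> * of_real \<sigma> * of_real \<omega> * \<i> * D \<tau>
          + (1/2) * of_real \<sigma> ^ 2 * D \<tau> ^ 2 - of_real b * D \<tau> - D' = 0 \<and>
        of_real r * of_real \<omega> * \<i> + of_real a * D \<tau> - C' = 0)"

text \<open>Square root and logarithm are the principal branches.\<close>

definition nsv_d :: "real \<Rightarrow> real \<Rightarrow> real \<Rightarrow> real \<Rightarrow> complex" where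
  "nsv_d b \<sigma> \<rho> \<omega> =
     csqrt ((of_real b - of_real \<rho> * of_real \<sigma> * \<i> * of_real \<omega>) ^ 2
            + of_real \<sigma> ^ 2 * of_real \<omega> ^ 2)"

definition nsv_g :: "real \<Rightarrow> real \<Rightarrow> real \<Rightarrow> real \<Rightarrow> complex" where
  "nsv_g b \<sigma> \<rho> \<omega> =
     (of_real b - of_real \<rho> * of_real \<sigma> * \<i> * of_real \<omega> - nsv_d b \<sigma> \<rho> \<omega>)
     / (of_real b - of_real \<rho> * of_real \<sigma> * \<i> * of_real \<omega> + nsv_d b \<sigma> \<rho> \<omega>)"

text \<open>
  The drift term of \<open>C\<close> is \<open>+ r \<i> \<omega> \<tau>\<close>.  It is also found in print with a minus sign, but since
  \<open>D 0 = 0\<close> the second equation of the system forces the derivative of \<open>C\<close> at \<open>0\<close> to be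
  \<open>r \<i> \<omega>\<close>, so the version with the minus sign solves the system only if \<open>r \<omega> = 0\<close>.
\<close>

definition nsv_C :: "real \<Rightarrow> real \<Rightarrow> real \<Rightarrow> real \<Rightarrow> real \<Rightarrow> real \<Rightarrow> real \<Rightarrow> complex" where
  "nsv_C a b r \<sigma> \<rho> \<omega> \<tau> =
     of_real r * \<i> * of_real \<omega> * of_real \<tau>
     + of_real a / of_real \<sigma> ^ 2 *
       ((of_real b - of_real \<rho> * of_real \<sigma> * \<i> * of_real \<omega> - nsv_d b \<sigma> \<rho> \<omega>) * of_real \<tau>
        - 2 * Ln ((1 - nsv_g b \<sigma> \<rho> \<omega> * exp (- nsv_d b \<sigma> \<rho> \<omega> * of_real \<tau>))
                  / (1 - nsv_g b \<sigma> \<rho> \<omega>)))"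

definition nsv_D :: "real \<Rightarrow> real \<Rightarrow> real \<Rightarrow> real \<Rightarrow> real \<Rightarrow> complex" where
  "nsv_D b \<sigma> \<rho> \<omega> \<tau> =
     (of_real b - of_real \<rho> * of_real \<sigma> * \<i> * of_real \<omega> - nsv_d b \<sigma> \<rho> \<omega>) / of_real \<sigma> ^ 2
     * ((1 - exp (- nsv_d b \<sigma> \<rho> \<omega> * of_real \<tau>))
        / (1 - nsv_g b \<sigma> \<rho> \<omega> * exp (- nsv_d b \<sigma> \<rho> \<omega> * of_real \<tau>)))"

end

theory Submission
  imports Defs
begin

text \<open>
  Put \<open>\<beta> = b - \<rho> \<sigma> \<i> \<omega>\<close>.  Since \<open>Re (d\<^sup>2) > 0\<close>, also \<open>Re d > 0\<close>; and \<open>d\<^sup>2 - \<beta>\<^sup>2\<close> is real, so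
  \<open>Im \<beta>\<close> and \<open>Im d\<close> have the same sign.  Hence \<open>\<bar>g\<bar> < 1\<close> and \<open>1 - g * exp (- d \<tau>)\<close> stays in the right
  half-plane, which keeps \<open>D\<close> finite and the logarithm in \<open>C\<close> off its branch cut; the system is
  then verified by differentiation.  Conversely, the difference of two solutions of the
  Riccati equation solves a homogeneous linear equation, so an integrating factor shows
  that it vanishes.
\<close>

section \<open>Estimates in the right half-plane\<close>

text \<open>The squared norms of \<open>\<beta> + d\<close> and \<open>\<beta> - d\<close> differ by
  \<open>4 * (Re \<beta> * Re d + Im \<beta> * Im d)\<close>, so it is enough that
  \<open>Im \<beta> * Im d\<close> is nonnegative. Equal imaginary parts of the squares give
  this.\<close>

lemma norm_diff_over_sum_less_1:
  fixes \<beta> d :: complex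
  assumes "Re \<beta> > 0" "Re d > 0" "Im (d\<^sup>2) = Im (\<beta>\<^sup>2)"
  shows "norm ((\<beta> - d) / (\<beta> + d)) < 1"
proof -
  have *: "Re d * Im d = Re \<beta> * Im \<beta>"
    using assms(3) by (simp add: Im_power2)
  have "Re d * (Im \<beta> * Im d) = Re \<beta> * (Im \<beta>)\<^sup>2"
    using * by (simp add: power2_eq_square algebra_simps)
  then have "Re d * (Im \<beta> * Im d) \<ge> 0"
    using assms(1) by simp
  then have "Im \<beta> * Im d \<ge> 0"
    using assms(2) by (simp add: zero_le_mult_iff)
  moreover have "Re \<beta> * Re d > 0"
    using assms by simp
  ultimately have "(norm (\<beta> - d))\<^sup>2 < (norm (\<beta> + d))\<^sup>2"
    unfolding cmod_power2 by (simp add: power2_eq_square algebra_simps)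
  then have "norm (\<beta> - d) < norm (\<beta> + d)"
    by (rule power_less_imp_less_base) simp
  then show ?thesis
    by (simp add: norm_divide divide_less_eq)
qed

text \<open>Both arguments lie strictly between \<open>-pi/2\<close> and \<open>pi/2\<close>, so
  their difference never reaches \<open>pi\<close>. This keeps the quotient inside \<open>Ln\<close>
  off the branch cut.\<close>

lemma divide_not_nonpos_Reals:
  fixes p q :: complex
  assumes "Re p > 0" "Re q > 0"
  shows "p / q \<notin> \<real>\<^sub>\<le>\<^sub>0"
proof
  assume "p / q \<in> \<real>\<^sub>\<le>\<^sub>0"
  then obtain x where x: "p / q = of_real x" "x \<le> 0"
    by (auto elim: nonpos_Reals_cases)
  have "q \<noteq> 0"
    using assms(2) by auto
  then have "p = of_real x * q"
    using x(1) by (simp add: field_simps)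
  then have "Re p = x * Re q"
    by simp
  then show False
    using assms x(2) mult_nonpos_nonneg[of x "Re q"] by simp
qed

lemma Re_one_minus_pos: "norm w < 1 \<Longrightarrow> Re (1 - w) > 0"
  using complex_Re_le_cmod[of w] by simp

section \<open>Derivatives of the closed forms\<close>

text \<open>Here \<open>s\<close> and \<open>w\<close> stand for \<sigma> squared and \<omega>
  squared. The condition \<open>s * w = d\<^sup>2 - \<beta>\<^sup>2\<close> says that
  \<open>(\<beta> - d) / s\<close> and \<open>(\<beta> + d) / s\<close> are the constant solutions
  of the Riccati equation.\<close>

lemma riccati_has_vector_derivative:
  fixes \<beta> d g s w :: complex and \<tau> :: real
  defines "X \<equiv> \<lambda>\<tau>. (\<beta> - d) / s * ((1 - exp (- d * of_real \<tau>)) / (1 - g * exp (- d * of_real \<tau>)))"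
  assumes "s \<noteq> 0" "\<beta> + d \<noteq> 0" "g = (\<beta> - d) / (\<beta> + d)" "s * w = d\<^sup>2 - \<beta>\<^sup>2"
    and "1 - g * exp (- d * of_real \<tau>) \<noteq> 0"
  shows "(X has_vector_derivative (s / 2 * (X \<tau>)\<^sup>2 - \<beta> * X \<tau> - w / 2)) (at \<tau> within A)"
proof -
  define E where "E = exp (- d * of_real \<tau>)"
  have nz: "1 - g * E \<noteq> 0"
    using assms(6) by (simp add: E_def)
  have gN: "g * (\<beta> + d) = \<beta> - d"
    using assms(3,4) by simp
  \<comment> \<open>The derivative given by the quotient rule, once its numerator has collapsed to
    \<open>d * E * (1 - g)\<close>.\<close>
  define Q where "Q = (\<beta> - d) / s * (d * E * (1 - g)) / (1 - g * E)\<^sup>2"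
  have "((\<lambda>z. (\<beta> - d) / s * ((1 - exp (- d * z)) / (1 - g * exp (- d * z)))) has_field_derivative
          (\<beta> - d) / s * ((d * E * (1 - g * E) - (1 - E) * (g * d * E)) / ((1 - g * E) * (1 - g * E))))
          (at (of_real \<tau>))"
    unfolding E_def using assms(6)
    by (intro DERIV_cmult DERIV_divide) (auto intro!: derivative_eq_intros)
  moreover have "d * E * (1 - g * E) - (1 - E) * (g * d * E) = d * E * (1 - g)"
    by (simp add: algebra_simps)
  ultimately have "((\<lambda>z. (\<beta> - d) / s * ((1 - exp (- d * z)) / (1 - g * exp (- d * z)))) has_field_derivative Q)
          (at (of_real \<tau>))"
    by (simp add: Q_def power2_eq_square)
  from has_vector_derivative_real_field[OF this]
  have "(X has_vector_derivative Q) (at \<tau> within A)"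
    unfolding X_def .
  moreover have "Q = s / 2 * (X \<tau>)\<^sup>2 - \<beta> * X \<tau> - w / 2"
  proof -
    have X: "X \<tau> = (\<beta> - d) * (1 - E) / (s * (1 - g * E))"
      by (simp add: X_def E_def)
    have w: "w = (d\<^sup>2 - \<beta>\<^sup>2) / s"
      using assms(2,5) by (simp add: field_simps)
    \<comment> \<open>The Riccati equation multiplied by \<open>2 * s * (1 - g * E)\<^sup>2\<close>:
      a polynomial identity modulo the relation \<open>gN\<close>.\<close>
    have "2 * ((\<beta> - d) * (d * E * (1 - g))) =
        ((\<beta> - d) * (1 - E))\<^sup>2 - 2 * \<beta> * ((\<beta> - d) * (1 - E)) * (1 - g * E) - (d\<^sup>2 - \<beta>\<^sup>2) * (1 - g * E)\<^sup>2"
      using gN by algebra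
    then have num: "((\<beta> - d) * (1 - E))\<^sup>2 - 2 * \<beta> * ((\<beta> - d) * (1 - E)) * (1 - g * E)
          - (d\<^sup>2 - \<beta>\<^sup>2) * (1 - g * E)\<^sup>2 = 2 * ((\<beta> - d) * (d * E * (1 - g)))"
      by (rule sym)
    have "s / 2 * (P / (s * M))\<^sup>2 - \<beta> * (P / (s * M)) - (K / s) / 2 =
        (P\<^sup>2 - 2 * \<beta> * P * M - K * M\<^sup>2) / (2 * s * M\<^sup>2)" if "M \<noteq> 0" for P M K
      using that assms(2) by (simp add: field_simps power2_eq_square)
    from this[OF nz, of "(\<beta> - d) * (1 - E)" "d\<^sup>2 - \<beta>\<^sup>2"] show ?thesis
      unfolding X w Q_def num by (simp add: mult.assoc)
  qed
  ultimately show ?thesis by simp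
qed

text \<open>Numerator and denominator both lie in the right half-plane, so \<open>Ln\<close> is
  differentiable at the quotient. The constant factor \<open>1 - g\<close> cancels in the
  logarithmic derivative.\<close>

lemma Ln_quotient_has_vector_derivative:
  fixes d g :: complex and \<tau> :: real
  assumes "norm g < 1" "norm (g * exp (- d * of_real \<tau>)) < 1"
  shows "((\<lambda>\<tau>. Ln ((1 - g * exp (- d * of_real \<tau>)) / (1 - g))) has_vector_derivative
           (g * d * exp (- d * of_real \<tau>) / (1 - g * exp (- d * of_real \<tau>)))) (at \<tau> within A)"
proof -
  have pos: "Re (1 - g) > 0" "Re (1 - g * exp (- d * of_real \<tau>)) > 0"
    using assms by (simp_all only: Re_one_minus_pos)
  then have nz: "1 - g \<noteq> 0" "1 - g * exp (- d * of_real \<tau>) \<noteq> 0"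
    using assms by auto
  have cut: "(1 - g * exp (- d * of_real \<tau>)) / (1 - g) \<notin> \<real>\<^sub>\<le>\<^sub>0"
    using divide_not_nonpos_Reals[OF pos(2,1)] .
  have "((\<lambda>z. (1 - g * exp (- d * z)) / (1 - g)) has_field_derivative
           (g * d * exp (- d * of_real \<tau>) / (1 - g))) (at (of_real \<tau>))"
    using nz by (intro DERIV_cdivide) (auto intro!: derivative_eq_intros)
  from DERIV_chain2[OF has_field_derivative_Ln[OF cut] this]
  have "((\<lambda>z. Ln ((1 - g * exp (- d * z)) / (1 - g))) has_field_derivative
           (g * d * exp (- d * of_real \<tau>) / (1 - g * exp (- d * of_real \<tau>)))) (at (of_real \<tau>))"
    using nz by (simp add: mult.assoc)
  from has_vector_derivative_real_field[OF this] show ?thesis .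
qed

section \<open>Homogeneous linear equations\<close>

text \<open>With \<open>F\<close> the integral of \<open>h\<close>, the product
  \<open>u * exp (- F)\<close> has derivative zero, so it keeps its initial value 0, and the
  exponential never vanishes.\<close>

lemma linear_homogeneous_ode_zero:
  fixes u h :: "real \<Rightarrow> complex"
  assumes "\<And>t. t \<in> {0..T} \<Longrightarrow> (u has_vector_derivative h t * u t) (at t within {0..T})"
    and "continuous_on {0..T} h" "u 0 = 0" "t \<in> {0..T}"
  shows "u t = 0"
proof -
  define F where "F = (\<lambda>x. integral {0..x} h)"
  have F: "(F has_vector_derivative h t) (at t within {0..T})" if "t \<in> {0..T}" for t
    unfolding F_def using integral_has_vector_derivative[OF assms(2) that] .
  have E: "((\<lambda>x. exp (- F x)) has_vector_derivative (- h t * exp (- F t))) (at t within {0..T})"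
    if "t \<in> {0..T}" for t
    using field_vector_diff_chain_within[OF has_vector_derivative_minus[OF F[OF that]], of exp "exp (- F t)"]
    by (simp add: o_def DERIV_subset[OF DERIV_exp])
  have "((\<lambda>x. u x * exp (- F x)) has_vector_derivative 0) (at t within {0..T})"
    if "t \<in> {0..T}" for t
    using has_vector_derivative_mult[OF assms(1)[OF that] E[OF that]]
    by (simp add: algebra_simps)
  then obtain c where c: "\<And>x. x \<in> {0..T} \<Longrightarrow> u x * exp (- F x) = c"
    using has_vector_derivative_zero_constant[of "{0..T}" "\<lambda>x. u x * exp (- F x)"] by auto
  have "c = 0"
    using c[of 0] assms(3,4) by auto
  then show ?thesis
    using c[OF assms(4)] by simp
qed

section \<open>The model's parameters and the derivatives of C and D\<close>

text \<open>Everything rests on \<open>Re (d\<^sup>2) = b\<^sup>2 + (1 - \<rho>\<^sup>2) *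
  \<sigma>\<^sup>2 * \<omega>\<^sup>2\<close>, which is positive because \<open>b > 0\<close> and
  \<rho> is a correlation.\<close>

lemma nsv_beta_properties:
  fixes b \<sigma> \<rho> \<omega> :: real
  defines "\<beta> \<equiv> complex_of_real b - of_real \<rho> * of_real \<sigma> * \<i> * of_real \<omega>"
  assumes "b > 0" "-1 \<le> \<rho>" "\<rho> \<le> 1"
  shows nsv_d_squared: "(nsv_d b \<sigma> \<rho> \<omega>)\<^sup>2 = \<beta>\<^sup>2 + of_real \<sigma> ^ 2 * of_real \<omega> ^ 2"
    and nsv_d_Re_pos: "Re (nsv_d b \<sigma> \<rho> \<omega>) > 0"
    and nsv_g_norm: "norm (nsv_g b \<sigma> \<rho> \<omega>) < 1"
    and nsv_beta_plus_d: "\<beta> + nsv_d b \<sigma> \<rho> \<omega> \<noteq> 0"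
proof -
  let ?d = "nsv_d b \<sigma> \<rho> \<omega>"
  show sq: "?d\<^sup>2 = \<beta>\<^sup>2 + of_real \<sigma> ^ 2 * of_real \<omega> ^ 2"
    unfolding nsv_d_def \<beta>_def by simp
  have "\<rho>\<^sup>2 \<le> 1"
    using assms(3,4) by (simp add: abs_square_le_1 abs_le_iff)
  then have "(1 - \<rho>\<^sup>2) * (\<sigma>\<^sup>2 * \<omega>\<^sup>2) \<ge> 0"
    by simp
  moreover have "Re (?d\<^sup>2) = b\<^sup>2 + (1 - \<rho>\<^sup>2) * (\<sigma>\<^sup>2 * \<omega>\<^sup>2)"
    unfolding sq \<beta>_def by (simp add: power2_eq_square algebra_simps)
  ultimately have "Re (?d\<^sup>2) > 0"
    using assms(2) by (simp add: add_pos_nonneg)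
  \<comment> \<open>The square of a purely imaginary number has nonpositive real part. The principal
    root then settles the sign.\<close>
  then have "Re ?d \<noteq> 0"
    by (auto simp: power2_eq_square not_less)
  moreover have "Re ?d \<ge> 0"
    unfolding nsv_d_def by (meson Re_csqrt)
  ultimately show d: "Re ?d > 0" by simp
  have \<beta>: "Re \<beta> > 0"
    using assms(2) by (simp add: \<beta>_def)
  have "Im (?d\<^sup>2) = Im (\<beta>\<^sup>2)"
    unfolding sq by (simp add: power2_eq_square)
  from norm_diff_over_sum_less_1[OF \<beta> d this]
  show "norm (nsv_g b \<sigma> \<rho> \<omega>) < 1"
    by (simp add: nsv_g_def \<beta>_def)
  show "\<beta> + ?d \<noteq> 0"
    using \<beta> d by (auto simp: complex_eq_iff)
qed

lemma nsv_g_exp_norm: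
  assumes "b > 0" "-1 \<le> \<rho>" "\<rho> \<le> 1" "\<tau> \<ge> 0"
  shows "norm (nsv_g b \<sigma> \<rho> \<omega> * exp (- nsv_d b \<sigma> \<rho> \<omega> * of_real \<tau>)) < 1"
proof -
  have "norm (exp (- nsv_d b \<sigma> \<rho> \<omega> * of_real \<tau>)) \<le> 1"
    using nsv_d_Re_pos[OF assms(1-3), of \<sigma> \<omega>] assms(4) by (simp add: norm_exp_eq_Re)
  then show ?thesis
    using nsv_g_norm[OF assms(1-3), of \<sigma> \<omega>]
    by (smt (verit) mult_left_le norm_ge_zero norm_mult)
qed

lemma nsv_D_has_vector_derivative:
  assumes "b > 0" "\<sigma> \<noteq> 0" "-1 \<le> \<rho>" "\<rho> \<le> 1" "\<tau> \<ge> 0"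
  shows "(nsv_D b \<sigma> \<rho> \<omega> has_vector_derivative
           (of_real \<sigma> ^ 2 / 2 * (nsv_D b \<sigma> \<rho> \<omega> \<tau>)\<^sup>2
            - (of_real b - of_real \<rho> * of_real \<sigma> * \<i> * of_real \<omega>) * nsv_D b \<sigma> \<rho> \<omega> \<tau>
            - of_real \<omega> ^ 2 / 2)) (at \<tau> within A)"
proof -
  have "1 - nsv_g b \<sigma> \<rho> \<omega> * exp (- nsv_d b \<sigma> \<rho> \<omega> * of_real \<tau>) \<noteq> 0"
    using nsv_g_exp_norm[OF assms(1,3,4,5), of \<sigma> \<omega>] by auto
  then show ?thesis
    unfolding nsv_D_def[abs_def]
    using assms nsv_d_squared[OF assms(1,3,4), of \<sigma> \<omega>] nsv_beta_plus_d[OF assms(1,3,4), of \<sigma> \<omega>]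
    by (intro riccati_has_vector_derivative) (simp_all add: nsv_g_def)
qed

lemma nsv_C_has_vector_derivative:
  assumes "b > 0" "\<sigma> \<noteq> 0" "-1 \<le> \<rho>" "\<rho> \<le> 1" "\<tau> \<ge> 0"
  shows "(nsv_C a b r \<sigma> \<rho> \<omega> has_vector_derivative
           (of_real r * \<i> * of_real \<omega> + of_real a * nsv_D b \<sigma> \<rho> \<omega> \<tau>)) (at \<tau> within A)"
proof -
  define \<beta> where "\<beta> = complex_of_real b - of_real \<rho> * of_real \<sigma> * \<i> * of_real \<omega>"
  define d where "d = nsv_d b \<sigma> \<rho> \<omega>"
  define g where "g = nsv_g b \<sigma> \<rho> \<omega>"
  define E where "E = exp (- d * of_real \<tau>)"
  have n: "norm g < 1" "norm (g * exp (- d * of_real \<tau>)) < 1"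
    using nsv_g_norm[OF assms(1,3,4)] nsv_g_exp_norm[OF assms(1,3,4,5)] by (auto simp: g_def d_def)
  have nz: "1 - g * E \<noteq> 0"
    using n(2) by (auto simp: E_def)
  have "g * (\<beta> + d) = \<beta> - d"
    using nsv_beta_plus_d[OF assms(1,3,4)] by (simp add: g_def nsv_g_def \<beta>_def d_def)
  \<comment> \<open>This is why the logarithm carries the factor 2: subtracting twice its derivative
    from the linear rate \<open>\<beta> - d\<close> leaves exactly \<open>\<sigma>\<^sup>2\<close>
    times \<open>nsv_D\<close>.\<close>
  then have "(\<beta> - d) * (1 - g * E) - 2 * (g * d * E) = (\<beta> - d) * (1 - E)"
    by algebra
  then have eq: "(\<beta> - d) - 2 * (g * d * E / (1 - g * E)) = (\<beta> - d) * ((1 - E) / (1 - g * E))"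
    using nz by (simp add: field_simps)
  have lin: "((\<lambda>x. c * complex_of_real x) has_vector_derivative c) (at \<tau> within A)" for c
    using has_vector_derivative_real_field[of "\<lambda>z. c * z" c \<tau>] by (auto intro!: derivative_eq_intros)
  have "(nsv_C a b r \<sigma> \<rho> \<omega> has_vector_derivative
          (of_real r * \<i> * of_real \<omega>
           + of_real a / of_real \<sigma> ^ 2 * ((\<beta> - d) - 2 * (g * d * E / (1 - g * E))))) (at \<tau> within A)"
    unfolding nsv_C_def[abs_def] \<beta>_def[symmetric] d_def[symmetric] g_def[symmetric] E_def
    by (intro has_vector_derivative_add has_vector_derivative_diff has_vector_derivative_mult_right
          lin Ln_quotient_has_vector_derivative n)
  then show ?thesis
    unfolding eq by (simp add: nsv_D_def \<beta>_def d_def g_def E_def)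
qed

section \<open>Existence and uniqueness\<close>

text \<open>Each equation is linear in its derivative, so the existential witnesses can be solved
  for. This leaves an explicit initial value problem.\<close>

lemma nsv_system_iff:
  "nsv_system a b r \<sigma> \<rho> \<omega> T C D \<longleftrightarrow>
     C 0 = 0 \<and> D 0 = 0 \<and>
     (\<forall>\<tau>\<in>{0..T}.
        (C has_vector_derivative (of_real r * \<i> * of_real \<omega> + of_real a * D \<tau>)) (at \<tau> within {0..T}) \<and>
        (D has_vector_derivative (of_real \<sigma> ^ 2 / 2 * (D \<tau>)\<^sup>2
            - (of_real b - of_real \<rho> * of_real \<sigma> * \<i> * of_real \<omega>) * D \<tau>
            - of_real \<omega> ^ 2 / 2)) (at \<tau> within {0..T}))"
proof -
  have "- (1/2) * of_real \<omega> ^ 2 + of_real \<rho> * of_real \<sigma> * of_real \<omega> * \<i> * X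
          + (1/2) * of_real \<sigma> ^ 2 * X ^ 2 - of_real b * X - D' = 0 \<longleftrightarrow>
        D' = of_real \<sigma> ^ 2 / 2 * X\<^sup>2
            - (of_real b - of_real \<rho> * of_real \<sigma> * \<i> * of_real \<omega>) * X - of_real \<omega> ^ 2 / 2"
    for D' X :: complex
    by (auto simp: algebra_simps)
  moreover have "of_real r * of_real \<omega> * \<i> + of_real a * X - C' = 0 \<longleftrightarrow>
        C' = of_real r * \<i> * of_real \<omega> + of_real a * X" for C' X :: complex
    by (auto simp: algebra_simps)
  ultimately show ?thesis
    unfolding nsv_system_def by simp
qed

lemma nsv_system_solution:
  assumes "b > 0" "\<sigma> \<noteq> 0" "-1 \<le> \<rho>" "\<rho> \<le> 1"
  shows "nsv_system a b r \<sigma> \<rho> \<omega> T (nsv_C a b r \<sigma> \<rho> \<omega>) (nsv_D b \<sigma> \<rho> \<omega>)"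
proof -
  \<comment> \<open>At time 0 the argument of the logarithm is \<open>(1 - g) / (1 - g)\<close>,
    which is 1 since \<open>g\<close> is not 1.\<close>
  have "1 - nsv_g b \<sigma> \<rho> \<omega> \<noteq> 0"
    using nsv_g_norm[OF assms(1,3,4), of \<sigma> \<omega>] by auto
  then have "nsv_C a b r \<sigma> \<rho> \<omega> 0 = 0" "nsv_D b \<sigma> \<rho> \<omega> 0 = 0"
    by (simp_all add: nsv_C_def nsv_D_def)
  then show ?thesis
    unfolding nsv_system_iff
    using nsv_C_has_vector_derivative[OF assms] nsv_D_has_vector_derivative[OF assms] by simp
qed

lemma nsv_system_unique:
  assumes "nsv_system a b r \<sigma> \<rho> \<omega> T C1 D1" "nsv_system a b r \<sigma> \<rho> \<omega> T C2 D2" "\<tau> \<in> {0..T}"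
  shows "C1 \<tau> = C2 \<tau> \<and> D1 \<tau> = D2 \<tau>"
proof -
  define \<beta> where "\<beta> = complex_of_real b - of_real \<rho> * of_real \<sigma> * \<i> * of_real \<omega>"
  note S1 = assms(1)[unfolded nsv_system_iff, folded \<beta>_def]
  note S2 = assms(2)[unfolded nsv_system_iff, folded \<beta>_def]
  \<comment> \<open>The coefficient comes from factoring \<open>D1 - D2\<close> out of the
    difference of the two Riccati right-hand sides. The constant terms cancel.\<close>
  define h where "h = (\<lambda>t. of_real \<sigma> ^ 2 / 2 * (D1 t + D2 t) - \<beta>)"
  have "continuous_on {0..T} D1" "continuous_on {0..T} D2"
    using S1 S2 by (auto intro: continuous_on_vector_derivative)
  then have h: "continuous_on {0..T} h"
    unfolding h_def by (intro continuous_intros)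
  have "((\<lambda>t. D1 t - D2 t) has_vector_derivative h t * (D1 t - D2 t)) (at t within {0..T})"
    if "t \<in> {0..T}" for t
  proof -
    have "h t * (D1 t - D2 t) =
        (of_real \<sigma> ^ 2 / 2 * (D1 t)\<^sup>2 - \<beta> * D1 t - of_real \<omega> ^ 2 / 2)
        - (of_real \<sigma> ^ 2 / 2 * (D2 t)\<^sup>2 - \<beta> * D2 t - of_real \<omega> ^ 2 / 2)"
      by (simp add: h_def power2_eq_square field_simps)
    then show ?thesis
      using S1 S2 that by (simp only: has_vector_derivative_diff)
  qed
  then have D: "D1 t = D2 t" if "t \<in> {0..T}" for t
    using linear_homogeneous_ode_zero[of T "\<lambda>t. D1 t - D2 t" h t] h S1 S2 that by simp
  \<comment> \<open>Once \<open>D1\<close> and \<open>D2\<close> agree, \<open>C1\<close> and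
    \<open>C2\<close> have the same derivative. The factor 0 puts this in the shape of the linear
    equation again.\<close>
  have "((\<lambda>t. C1 t - C2 t) has_vector_derivative 0 * (C1 t - C2 t)) (at t within {0..T})"
    if "t \<in> {0..T}" for t
  proof -
    have "(C1 has_vector_derivative (of_real r * \<i> * of_real \<omega> + of_real a * D1 t)) (at t within {0..T})"
      "(C2 has_vector_derivative (of_real r * \<i> * of_real \<omega> + of_real a * D1 t)) (at t within {0..T})"
      using S1 S2 D that by auto
    from has_vector_derivative_diff[OF this] show ?thesis by simp
  qed
  then have "C1 \<tau> - C2 \<tau> = 0"
    using linear_homogeneous_ode_zero[of T "\<lambda>t. C1 t - C2 t" "\<lambda>_. 0" \<tau>] S1 S2 assms(3) by simp
  then show ?thesis
    using D assms(3) by simp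
qed

text \<open>Derivatives within \<open>{0..T}\<close> depend only on values in that interval, and
  \<open>T \<ge> 0\<close> places the initial point in it. Hence agreement with a solution on
  \<open>{0..T}\<close> suffices.\<close>

lemma nsv_system_cong:
  assumes "nsv_system a b r \<sigma> \<rho> \<omega> T C1 D1" "T \<ge> 0"
    and eq: "\<And>\<tau>. \<tau> \<in> {0..T} \<Longrightarrow> C2 \<tau> = C1 \<tau>" "\<And>\<tau>. \<tau> \<in> {0..T} \<Longrightarrow> D2 \<tau> = D1 \<tau>"
  shows "nsv_system a b r \<sigma> \<rho> \<omega> T C2 D2"
proof -
  have "(C2 has_vector_derivative X) (at \<tau> within {0..T}) \<longleftrightarrow>
        (C1 has_vector_derivative X) (at \<tau> within {0..T})"
    "(D2 has_vector_derivative X) (at \<tau> within {0..T}) \<longleftrightarrow>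
        (D1 has_vector_derivative X) (at \<tau> within {0..T})"
    if "\<tau> \<in> {0..T}" for \<tau> X
    using has_vector_derivative_transform[OF that, of C1 C2] has_vector_derivative_transform[OF that, of C2 C1]
      has_vector_derivative_transform[OF that, of D1 D2] has_vector_derivative_transform[OF that, of D2 D1] eq
    by (auto simp del: atLeastAtMost_iff)
  then show ?thesis
    using assms unfolding nsv_system_iff by simp
qed

theorem mainTheorem1:
  fixes a b r \<sigma> \<rho> \<omega> T :: real and C D :: "real \<Rightarrow> complex"
  assumes "b > 0" and "\<sigma> \<noteq> 0" and "-1 \<le> \<rho>" and "\<rho> \<le> 1" and "T > 0"
  shows "nsv_system a b r \<sigma> \<rho> \<omega> T C D \<longleftrightarrow>
         (\<forall>\<tau>\<in>{0..T}. C \<tau> = nsv_C a b r \<sigma> \<rho> \<omega> \<tau> \<and> D \<tau> = nsv_D b \<sigma> \<rho> \<omega> \<tau>)"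
proof -
  note sol = nsv_system_solution[OF assms(1-4), of a r \<omega> T]
  show ?thesis
  proof
    assume "nsv_system a b r \<sigma> \<rho> \<omega> T C D"
    then show "\<forall>\<tau>\<in>{0..T}. C \<tau> = nsv_C a b r \<sigma> \<rho> \<omega> \<tau> \<and> D \<tau> = nsv_D b \<sigma> \<rho> \<omega> \<tau>"
      using nsv_system_unique sol by blast
  next
    assume "\<forall>\<tau>\<in>{0..T}. C \<tau> = nsv_C a b r \<sigma> \<rho> \<omega> \<tau> \<and> D \<tau> = nsv_D b \<sigma> \<rho> \<omega> \<tau>"
    then show "nsv_system a b r \<sigma> \<rho> \<omega> T C D"
      using nsv_system_cong[OF sol] assms(5) by simp
  qed
qed

end
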